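(* Let $n\ge 2$. For every $\alpha\in(0,1)$ there exists a constant $c_{\alpha,n}$, depending only on $\alpha$ and $n$, such that for every $f\in C_c^\infty(\mathbb{R}^n)$ and every $x\in\mathbb{R}^n$, $$(1-\alpha)\,I_\alpha(\mathcal{D}^\alpha f)(x)\le c_{\alpha,n}\,I_1(|\nabla f|)(x),$$ and these constants can be chosen so that $c_{\alpha,n}$ remains bounded by a constant depending only on $n$ as $\alpha\to1^-$.
   Context: The Riesz potential is $I_\alpha g(x)=\int_{\mathbb{R}^n}\frac{g(y)}{|x-y|^{n-\alpha}}\,dy$ for $0<\alpha<n$ (no normalizing constant). The nonlinear fractional differential operator is, for $0<\alpha<1$, $$\mathcal{D}^\alpha f(x)=\int_{\mathbb{R}^n}\frac{|f(x)-f(y)|}{|x-y|^{n+\alpha}}\,dy.$$ *)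

theory Defs
  imports "HOL-Analysis.Analysis"
begin

text \<open>
  \<open>C_diff k f\<close> says that \<open>f\<close> is of class \<open>C\<^sup>k\<close> on the whole space: the recursion runs through
  all directional derivatives, so at level \<open>k\<close> all iterated directional derivatives of order
  up to \<open>k\<close> exist and are continuous.
\<close>

fun C_diff :: "nat \<Rightarrow> ('a::euclidean_space \<Rightarrow> real) \<Rightarrow> bool" where
  "C_diff 0 f \<longleftrightarrow> continuous_on UNIV f"
| "C_diff (Suc k) f \<longleftrightarrow>
     (\<forall>x. f differentiable (at x)) \<and> (\<forall>v. C_diff k (\<lambda>x. frechet_derivative f (at x) v))"

definition Cc_infinity :: "('a::euclidean_space \<Rightarrow> real) set" where
  "Cc_infinity = {f. (\<forall>k. C_diff k f) \<and> compact (closure {x. f x \<noteq> 0})}"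

definition gradient :: "(real^'n \<Rightarrow> real) \<Rightarrow> real^'n \<Rightarrow> real^'n" where
  "gradient f x = (\<chi> i. frechet_derivative f (at x) (axis i 1))"

lemma GDERIV_gradient:
  fixes f :: "real^'n \<Rightarrow> real"
  assumes "f differentiable (at x)"
  shows "GDERIV f x :> gradient f x"
proof -
  let ?D = "frechet_derivative f (at x)"
  have D: "(f has_derivative ?D) (at x)"
    using assms frechet_derivative_works by blast
  then have lin: "linear ?D"
    by (rule has_derivative_linear)
  have "?D h = inner h (gradient f x)" for h
  proof -
    have "?D h = ?D (\<Sum>i\<in>UNIV. (h $ i) *\<^sub>R axis i 1)"
      by (simp add: basis_expansion flip: scalar_mult_eq_scaleR)
    also have "\<dots> = (\<Sum>i\<in>UNIV. (h $ i) *\<^sub>R ?D (axis i 1))"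
      by (simp add: linear_sum[OF lin] linear_cmul[OF lin])
    also have "\<dots> = inner h (gradient f x)"
      by (simp add: inner_vec_def gradient_def)
    finally show ?thesis .
  qed
  then have "?D = (\<lambda>h. inner h (gradient f x))"
    by (rule ext)
  with D show ?thesis
    by (simp add: gderiv_def)
qed

text \<open>
  Both operators below are integrals of nonnegative functions, taken as Lebesgue integrals with
  values in \<open>[0,\<infinity>]\<close>; hence a divergent integral has the value \<open>\<infinity>\<close>, and an inequality with a finite
  right-hand side includes the finiteness of the left-hand side.  The value of the integrands
  at the single point \<open>y = x\<close> is immaterial.
\<close>

definition riesz_potential :: "real \<Rightarrow> (real^'n \<Rightarrow> ennreal) \<Rightarrow> real^'n \<Rightarrow> ennreal" where
  "riesz_potential \<alpha> g x =
     (\<integral>\<^sup>+ y. g y / ennreal (norm (x - y) powr (real CARD('n) - \<alpha>)) \<partial>lborel)"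

definition nonlinear_frac_diff :: "real \<Rightarrow> (real^'n \<Rightarrow> real) \<Rightarrow> real^'n \<Rightarrow> ennreal" where
  "nonlinear_frac_diff \<alpha> f x =
     (\<integral>\<^sup>+ y. ennreal (\<bar>f x - f y\<bar> / norm (x - y) powr (real CARD('n) + \<alpha>)) \<partial>lborel)"

end

theory Submission
  imports Defs
begin

text \<open>
  The fundamental theorem of calculus along the segment from \<open>y\<close> to \<open>y + h\<close> gives
  \<open>\<bar>f y - f (y + h)\<bar> \<le> \<bar>h\<bar> \<integral>\<^sub>0\<^sup>1 \<bar>\<nabla>f (y + t h)\<bar> dt\<close>.  Everything in sight is nonnegative, so after
  inserting this bound Tonelli's theorem allows the integrations to be done in any order.  With the
  substitution \<open>w = y + t h\<close>, the potential \<open>I\<^sub>\<alpha> (D\<^sup>\<alpha> f) x\<close> is at most the integral of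
  \<open>\<bar>\<nabla>f w\<bar>\<close> against the weight
  \<open>\<integral>\<^sub>0\<^sup>1 J t (x - w) dt\<close>, where \<open>J t u = \<integral> \<bar>h\<bar>\<^bsup>1 - n - \<alpha>\<^esup> \<bar>u + t h\<bar>\<^bsup>\<alpha> - n\<^esup> dh\<close>.

  The rest is about this kernel.  Scaling gives \<open>J t u = t\<^bsup>\<alpha> - 1\<^esup> J 1 u\<close>, and
  \<open>\<integral>\<^sub>0\<^sup>1 t\<^bsup>\<alpha> - 1\<^esup> dt = 1 / \<alpha>\<close>.  The integral \<open>J 1 u\<close> is a convolution of two
  locally integrable powers; its integrand decays like \<open>\<bar>h\<bar>\<^bsup>1 - 2n\<^esup>\<close> at infinity, which is
  integrable because \<open>n \<ge> 2\<close>.  Hence \<open>J 1 u\<close> is bounded by a multiple of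
  \<open>\<bar>u\<bar>\<^bsup>1 - n\<^esup>\<close>, the kernel of \<open>I\<^sub>1\<close> (\<open>power_kernel_convolution_bound\<close>).  In that
  bound only the singularity \<open>\<bar>h\<bar>\<^bsup>1 - n - \<alpha>\<^esup>\<close> degenerates as \<open>\<alpha> \<rightarrow> 1\<close>: it
  contributes a term of order \<open>1 / (1 - \<alpha>)\<close>, which the factor \<open>1 - \<alpha>\<close> of the theorem cancels.
\<close>

section \<open>Affine substitutions\<close>

lemma nn_integral_lborel_translate:
  fixes F :: "'a::euclidean_space \<Rightarrow> ennreal"
  assumes [measurable]: "F \<in> borel_measurable borel"
  shows "(\<integral>\<^sup>+y. F (c + y) \<partial>lborel) = (\<integral>\<^sup>+y. F y \<partial>lborel)"
proof -
  have "(\<integral>\<^sup>+y. F y \<partial>lborel) = (\<integral>\<^sup>+y. F y \<partial>(distr lborel borel ((+) c)))"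
    by (simp add: lborel_distr_plus)
  also have "\<dots> = (\<integral>\<^sup>+y. F (c + y) \<partial>lborel)"
    by (rule nn_integral_distr) simp_all
  finally show ?thesis ..
qed

lemma nn_integral_lborel_scale:
  fixes F :: "'a::euclidean_space \<Rightarrow> ennreal"
  assumes [measurable]: "F \<in> borel_measurable borel" and c: "c > 0"
  shows "(\<integral>\<^sup>+y. F y \<partial>lborel) = ennreal (c ^ DIM('a)) * (\<integral>\<^sup>+y. F (c *\<^sub>R y) \<partial>lborel)"
proof -
  have "(\<integral>\<^sup>+y. F y \<partial>lborel)
      = (\<integral>\<^sup>+y. F y \<partial>(density (distr lborel borel (\<lambda>x. 0 + c *\<^sub>R x)) (\<lambda>_. ennreal (\<bar>c\<bar>^DIM('a)))))"
    using c lborel_affine[of c "0::'a"] by (simp only: refl less_imp_neq[symmetric] not_False_eq_True)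
  also have "\<dots> = (\<integral>\<^sup>+y. ennreal (c ^ DIM('a)) * F (c *\<^sub>R y) \<partial>lborel)"
    using c by (subst nn_integral_density) (simp_all add: nn_integral_distr)
  also have "\<dots> = ennreal (c ^ DIM('a)) * (\<integral>\<^sup>+y. F (c *\<^sub>R y) \<partial>lborel)"
    by (rule nn_integral_cmult) measurable
  finally show ?thesis .
qed

section \<open>Radial integrals\<close>

text \<open>
  Exchanging the integrals leaves, for each \<open>s\<close>, the volume of the ball of radius \<open>s\<close>.  A radial
  function \<open>\<phi> (norm k)\<close> with \<open>\<phi>\<close> decreasing to zero has the form on the left, with \<open>w\<close> the density
  of \<open>- \<phi>\<close>; so its integral reduces to one over the half line, without polar coordinates.
\<close>

lemma nn_integral_layer_cake_norm:
  fixes w :: "real \<Rightarrow> ennreal"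
  assumes [measurable]: "w \<in> borel_measurable borel"
  shows "(\<integral>\<^sup>+(k::'a::euclidean_space). (\<integral>\<^sup>+s. w s * indicator {norm k..} s \<partial>lborel) \<partial>lborel)
       = (\<integral>\<^sup>+s. w s * ennreal (unit_ball_vol (real DIM('a)) * s ^ DIM('a)) * indicator {0..} s \<partial>lborel)"
proof -
  have [measurable]: "(\<lambda>(s, k::'a). indicator {norm k..} s :: ennreal) \<in> borel_measurable (lborel \<Otimes>\<^sub>M lborel)"
  proof -
    have "(\<lambda>(s, k::'a). indicator {norm k..} s :: ennreal) = indicator {p. norm (snd p) \<le> fst p}"
      by (auto simp: fun_eq_iff split: split_indicator)
    moreover have "{p :: real \<times> 'a. norm (snd p) \<le> fst p} \<in> sets (borel \<Otimes>\<^sub>M borel)"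
      unfolding borel_prod by (intro borel_closed closed_Collect_le continuous_intros)
    ultimately show ?thesis by simp
  qed
  have "(\<integral>\<^sup>+(k::'a). (\<integral>\<^sup>+s. w s * indicator {norm k..} s \<partial>lborel) \<partial>lborel)
      = (\<integral>\<^sup>+s. (\<integral>\<^sup>+(k::'a). w s * indicator {norm k..} s \<partial>lborel) \<partial>lborel)"
    by (rule lborel_pair.Fubini') measurable
  also have "\<dots> = (\<integral>\<^sup>+s. (\<integral>\<^sup>+(k::'a). w s * indicator (cball 0 s) k \<partial>lborel) \<partial>lborel)"
    by (intro nn_integral_cong) (auto split: split_indicator)
  also have "\<dots> = (\<integral>\<^sup>+s. w s * emeasure lborel (cball 0 s :: 'a set) \<partial>lborel)"
    by (simp add: nn_integral_cmult_indicator)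
  also have "\<dots> = (\<integral>\<^sup>+s. w s * ennreal (unit_ball_vol (real DIM('a)) * s ^ DIM('a)) * indicator {0..} s \<partial>lborel)"
    by (intro nn_integral_cong) (auto simp: emeasure_cball split: split_indicator)
  finally show ?thesis .
qed

lemma nn_integral_indicator_has_integral:
  fixes f :: "'a::euclidean_space \<Rightarrow> real"
  assumes "\<And>x. x \<in> A \<Longrightarrow> 0 \<le> f x" and "(f has_integral J) A"
  shows "(\<integral>\<^sup>+x. ennreal (f x) * indicator A x \<partial>lborel) = ennreal J"
proof -
  have "(\<integral>\<^sup>+x. ennreal (f x) * indicator A x \<partial>lborel) = (\<integral>\<^sup>+x. ennreal (indicator A x * f x) \<partial>lborel)"
    by (intro nn_integral_cong) (auto split: split_indicator)
  with nn_integral_has_integral_lebesgue[OF assms] show ?thesis by simp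
qed

lemma nn_integral_powr_tail:
  fixes a e :: real
  assumes "a > 0" "e > 0"
  shows "(\<integral>\<^sup>+s. ennreal (s powr (- e - 1)) * indicator {a..} s \<partial>lborel) = ennreal (a powr (- e) / e)"
  using nn_integral_indicator_has_integral[OF _ has_integral_powr_to_inf[of "- e - 1" a]] assms
  by simp

lemma nn_integral_powr_from_0:
  fixes a e :: real
  assumes "a \<ge> 0" "e > 0"
  shows "(\<integral>\<^sup>+s. ennreal (s powr (e - 1)) * indicator {0..a} s \<partial>lborel) = ennreal (a powr e / e)"
  using nn_integral_indicator_has_integral[OF _ has_integral_powr_from_0[of "e - 1" a]] assms
  by simp

lemma nn_integral_powr_Icc:
  fixes a b e :: real
  assumes "0 < a" "a \<le> b" "e > 0"
  shows "(\<integral>\<^sup>+s. ennreal (e * s powr (- e - 1)) * indicator {a..b} s \<partial>lborel)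
       = ennreal (a powr (- e) - b powr (- e))"
proof -
  have "(\<integral>\<^sup>+s. ennreal (e * s powr (- e - 1)) * indicator {a..b} s \<partial>lborel)
      = ennreal (- (b powr (- e)) - - (a powr (- e)))"
    using assms
    by (intro nn_integral_FTC_Icc)
       (auto intro!: derivative_eq_intros simp: has_real_derivative_iff_has_vector_derivative[symmetric])
  then show ?thesis by simp
qed

text \<open>
  The radial profile \<open>t\<^bsup>-\<beta>\<^esup> (max R t)\<^bsup>-\<gamma>\<^esup>\<close> behaves like \<open>t\<^bsup>-\<beta>\<^esup>\<close> near the origin and like
  \<open>t\<^bsup>-(\<beta> + \<gamma>)\<^esup>\<close> beyond \<open>R\<close>.  The conditions \<open>\<beta> < n\<close> and \<open>\<beta> + \<gamma> > n\<close> are integrability at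
  \<open>0\<close> and at \<open>\<infinity>\<close>, and the two summands of the constant come from these two regions.
\<close>

lemma nn_integral_two_power_radial:
  fixes \<beta> \<gamma> R :: real
  assumes \<beta>: "0 < \<beta>" "\<beta> < real DIM('a::euclidean_space)" and s: "real DIM('a) < \<beta> + \<gamma>" and R: "R > 0"
  shows "(\<integral>\<^sup>+(k::'a). ennreal (norm k powr (- \<beta>) * max R (norm k) powr (- \<gamma>)) \<partial>lborel)
    \<le> ennreal (unit_ball_vol (real DIM('a)) * R powr (real DIM('a) - \<beta> - \<gamma>)
          * (\<beta> / (real DIM('a) - \<beta>) + (\<beta> + \<gamma>) / (\<beta> + \<gamma> - real DIM('a))))"
proof -
  define n where "n = real DIM('a)"
  define V where "V = unit_ball_vol n"
  have V: "V \<ge> 0" by (simp add: V_def n_def)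
  have n: "\<beta> < n" "n < \<beta> + \<gamma>" using \<beta> s by (simp_all add: n_def)
  \<comment> \<open>\<open>w1 + w2\<close> is minus the derivative of the profile, piece by piece.\<close>
  define w1 where "w1 s = ennreal (\<beta> * s powr (- \<beta> - 1)) * indicator {0..R} s * ennreal (R powr (- \<gamma>))" for s :: real
  define w2 where "w2 s = ennreal (\<beta> + \<gamma>) * (ennreal (s powr (- (\<beta> + \<gamma>) - 1)) * indicator {R..} s)" for s :: real
  have [measurable]: "w1 \<in> borel_measurable borel" "w2 \<in> borel_measurable borel"
    unfolding w1_def[abs_def] w2_def[abs_def] by measurable
  have tail: "(\<integral>\<^sup>+s. w2 s * indicator {t..} s \<partial>lborel) = ennreal (max R t powr (- (\<beta> + \<gamma>)))" for t
  proof -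
    have "(\<integral>\<^sup>+s. w2 s * indicator {t..} s \<partial>lborel)
      = (\<integral>\<^sup>+s. ennreal (\<beta> + \<gamma>) * (ennreal (s powr (- (\<beta> + \<gamma>) - 1)) * indicator {max R t..} s) \<partial>lborel)"
      by (intro nn_integral_cong) (auto simp: w2_def split: split_indicator)
    also have "\<dots> = ennreal (\<beta> + \<gamma>) * ennreal (max R t powr (- (\<beta> + \<gamma>)) / (\<beta> + \<gamma>))"
      using R n \<beta> by (subst nn_integral_cmult, measurable, subst nn_integral_powr_tail) auto
    also have "\<dots> = ennreal (max R t powr (- (\<beta> + \<gamma>)))"
      using n \<beta> by (simp add: ennreal_mult'[symmetric] del: ennreal_plus)
    finally show ?thesis .
  qed
  have pointwise: "ennreal (norm k powr (- \<beta>) * max R (norm k) powr (- \<gamma>))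
      \<le> (\<integral>\<^sup>+s. (w1 s + w2 s) * indicator {norm k..} s \<partial>lborel)" for k :: 'a
  proof (cases "k = 0")
    case False
    define t where "t = norm k"
    have t: "t > 0" using False by (simp add: t_def)
    have split: "(\<integral>\<^sup>+s. (w1 s + w2 s) * indicator {t..} s \<partial>lborel)
       = (\<integral>\<^sup>+s. w1 s * indicator {t..} s \<partial>lborel) + ennreal (max R t powr (- (\<beta> + \<gamma>)))"
      by (simp add: distrib_right nn_integral_add tail)
    have "ennreal (t powr (- \<beta>) * max R t powr (- \<gamma>)) \<le> (\<integral>\<^sup>+s. (w1 s + w2 s) * indicator {t..} s \<partial>lborel)"
    proof (cases "t \<ge> R")
      case True
      then have "t powr (- \<beta>) * max R t powr (- \<gamma>) = max R t powr (- (\<beta> + \<gamma>))"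
        by (simp add: max_def powr_add[symmetric])
      then show ?thesis unfolding split by simp
    next
      case False
      have "(\<integral>\<^sup>+s. w1 s * indicator {t..} s \<partial>lborel)
        = (\<integral>\<^sup>+s. (ennreal (\<beta> * s powr (- \<beta> - 1)) * indicator {t..R} s) * ennreal (R powr (- \<gamma>)) \<partial>lborel)"
        using t by (intro nn_integral_cong) (auto simp: w1_def split: split_indicator)
      also have "\<dots> = ennreal (t powr (- \<beta>) - R powr (- \<beta>)) * ennreal (R powr (- \<gamma>))"
        using False t \<beta> by (subst nn_integral_multc) (auto simp: nn_integral_powr_Icc)
      also have "\<dots> = ennreal ((t powr (- \<beta>) - R powr (- \<beta>)) * R powr (- \<gamma>))"
        by (simp add: ennreal_mult'')
      finally have e: "(\<integral>\<^sup>+s. w1 s * indicator {t..} s \<partial>lborel)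
          = ennreal ((t powr (- \<beta>) - R powr (- \<beta>)) * R powr (- \<gamma>))" .
      have "t powr (- \<beta>) \<ge> R powr (- \<beta>)"
        using False t \<beta> by (intro powr_mono2') auto
      then have "(\<integral>\<^sup>+s. (w1 s + w2 s) * indicator {t..} s \<partial>lborel)
          = ennreal ((t powr (- \<beta>) - R powr (- \<beta>)) * R powr (- \<gamma>) + R powr (- (\<beta> + \<gamma>)))"
        using False unfolding split e by (subst ennreal_plus) (auto simp: max_def)
      also have "(t powr (- \<beta>) - R powr (- \<beta>)) * R powr (- \<gamma>) + R powr (- (\<beta> + \<gamma>))
          = t powr (- \<beta>) * max R t powr (- \<gamma>)"
        using False by (simp add: max_def algebra_simps powr_add[symmetric])
      finally show ?thesis by simp
    qed
    then show ?thesis by (simp add: t_def)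
  qed simp
  have pw: "s powr p * s ^ DIM('a) = s powr (n + p)" if "s \<ge> 0" for s p :: real
    using that by (cases "s = 0") (simp_all add: n_def powr_add powr_realpow)
  have near: "(\<integral>\<^sup>+s. w1 s * ennreal (V * s ^ DIM('a)) * indicator {0..} s \<partial>lborel)
      = ennreal (V * R powr (n - \<beta> - \<gamma>) * (\<beta> / (n - \<beta>)))"
  proof -
    have "(\<integral>\<^sup>+s. w1 s * ennreal (V * s ^ DIM('a)) * indicator {0..} s \<partial>lborel)
      = (\<integral>\<^sup>+s. ennreal (V * \<beta> * R powr (- \<gamma>)) * (ennreal (s powr ((n - \<beta>) - 1)) * indicator {0..R} s) \<partial>lborel)"
    proof (intro nn_integral_cong)
      fix s :: real
      have "\<beta> * s powr (- \<beta> - 1) * R powr (- \<gamma>) * (V * s ^ DIM('a)) = V * \<beta> * R powr (- \<gamma>) * s powr ((n - \<beta>) - 1)"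
        if "s \<ge> 0"
        using pw[OF that, of "- \<beta> - 1"] by (simp add: algebra_simps)
      then show "w1 s * ennreal (V * s ^ DIM('a)) * indicator {0..} s
         = ennreal (V * \<beta> * R powr (- \<gamma>)) * (ennreal (s powr ((n - \<beta>) - 1)) * indicator {0..R} s)"
        using V \<beta> by (auto simp: w1_def ennreal_mult'[symmetric] split: split_indicator)
    qed
    also have "\<dots> = ennreal (V * \<beta> * R powr (- \<gamma>)) * ennreal (R powr (n - \<beta>) / (n - \<beta>))"
      using n R by (subst nn_integral_cmult) (auto simp: nn_integral_powr_from_0)
    also have "\<dots> = ennreal (V * (R powr (- \<gamma>) * R powr (n - \<beta>)) * (\<beta> / (n - \<beta>)))"
      using V \<beta> n by (simp add: ennreal_mult'[symmetric] algebra_simps)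
    also have "R powr (- \<gamma>) * R powr (n - \<beta>) = R powr (n - \<beta> - \<gamma>)"
      by (simp add: powr_add[symmetric])
    finally show ?thesis .
  qed
  have far: "(\<integral>\<^sup>+s. w2 s * ennreal (V * s ^ DIM('a)) * indicator {0..} s \<partial>lborel)
      = ennreal (V * R powr (n - \<beta> - \<gamma>) * ((\<beta> + \<gamma>) / (\<beta> + \<gamma> - n)))"
  proof -
    have "(\<integral>\<^sup>+s. w2 s * ennreal (V * s ^ DIM('a)) * indicator {0..} s \<partial>lborel)
      = (\<integral>\<^sup>+s. ennreal (V * (\<beta> + \<gamma>)) * (ennreal (s powr (- (\<beta> + \<gamma> - n) - 1)) * indicator {R..} s) \<partial>lborel)"
    proof (intro nn_integral_cong)
      fix s :: real
      have "(\<beta> + \<gamma>) * s powr (- (\<beta> + \<gamma>) - 1) * (V * s ^ DIM('a)) = V * (\<beta> + \<gamma>) * s powr (- (\<beta> + \<gamma> - n) - 1)"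
        if "s \<ge> 0"
        using pw[OF that, of "- (\<beta> + \<gamma>) - 1"] by (simp add: algebra_simps)
      then show "w2 s * ennreal (V * s ^ DIM('a)) * indicator {0..} s
         = ennreal (V * (\<beta> + \<gamma>)) * (ennreal (s powr (- (\<beta> + \<gamma> - n) - 1)) * indicator {R..} s)"
        using V \<beta> n R by (auto simp: w2_def ennreal_mult'[symmetric] simp del: ennreal_plus split: split_indicator)
    qed
    also have "\<dots> = ennreal (V * (\<beta> + \<gamma>)) * ennreal (R powr (- (\<beta> + \<gamma> - n)) / (\<beta> + \<gamma> - n))"
      using n R by (subst nn_integral_cmult, measurable, subst nn_integral_powr_tail) auto
    also have "\<dots> = ennreal (V * (\<beta> + \<gamma>) * (R powr (- (\<beta> + \<gamma> - n)) / (\<beta> + \<gamma> - n)))"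
      using V \<beta> n by (intro ennreal_mult'[symmetric]) simp
    also have "- (\<beta> + \<gamma> - n) = n - \<beta> - \<gamma>" by simp
    also have "V * (\<beta> + \<gamma>) * (R powr (n - \<beta> - \<gamma>) / (\<beta> + \<gamma> - n))
        = V * R powr (n - \<beta> - \<gamma>) * ((\<beta> + \<gamma>) / (\<beta> + \<gamma> - n))" by simp
    finally show ?thesis .
  qed
  have "(\<integral>\<^sup>+(k::'a). ennreal (norm k powr (- \<beta>) * max R (norm k) powr (- \<gamma>)) \<partial>lborel)
      \<le> (\<integral>\<^sup>+(k::'a). (\<integral>\<^sup>+s. (w1 s + w2 s) * indicator {norm k..} s \<partial>lborel) \<partial>lborel)"
    by (intro nn_integral_mono pointwise)
  also have "\<dots> = (\<integral>\<^sup>+s. (w1 s + w2 s) * ennreal (V * s ^ DIM('a)) * indicator {0..} s \<partial>lborel)"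
    unfolding V_def n_def by (rule nn_integral_layer_cake_norm) measurable
  also have "\<dots> = ennreal (V * R powr (n - \<beta> - \<gamma>) * (\<beta> / (n - \<beta>)))
      + ennreal (V * R powr (n - \<beta> - \<gamma>) * ((\<beta> + \<gamma>) / (\<beta> + \<gamma> - n)))"
    by (simp add: distrib_right nn_integral_add near far)
  also have "\<dots> = ennreal (V * R powr (n - \<beta> - \<gamma>) * (\<beta> / (n - \<beta>) + (\<beta> + \<gamma>) / (\<beta> + \<gamma> - n)))"
    using V \<beta> n by (subst ennreal_plus[symmetric]) (auto simp: distrib_left)
  finally show ?thesis by (simp add: V_def n_def)
qed

section \<open>Convolution of two power kernels\<close>

text \<open>
  The first two summands measure the singularities of the two powers; the third, which comes from
  infinity, occurs twice because the space is divided into two parts that both reach infinity.  The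
  power of two arises because each singularity is isolated in a ball of radius \<open>\<bar>u\<bar> / 2\<close>.
\<close>

definition convolution_const :: "real \<Rightarrow> real \<Rightarrow> real \<Rightarrow> real" where
  "convolution_const n \<beta> \<gamma> = unit_ball_vol n * 2 powr (\<beta> + \<gamma> - n)
     * (\<beta> / (n - \<beta>) + \<gamma> / (n - \<gamma>) + 2 * (\<beta> + \<gamma>) / (\<beta> + \<gamma> - n))"

text \<open>
  Where \<open>k\<close> is closer to \<open>0\<close> than to \<open>-u\<close>, the triangle inequality gives
  \<open>\<bar>u + k\<bar> \<ge> max (\<bar>u\<bar> / 2) \<bar>k\<bar>\<close>, and the integrand is dominated by a radial profile around \<open>0\<close>.  In
  the other half of the space the roles of the two points, and of the exponents, are exchanged.
\<close>

lemma power_kernel_convolution_bound: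
  fixes u :: "'a::euclidean_space" and \<beta> \<gamma> :: real
  assumes \<beta>: "0 < \<beta>" "\<beta> < real DIM('a)" and \<gamma>: "0 < \<gamma>" "\<gamma> < real DIM('a)"
    and s: "real DIM('a) < \<beta> + \<gamma>" and u: "u \<noteq> 0"
  shows "(\<integral>\<^sup>+k. ennreal (norm k powr (- \<beta>) * norm (u + k) powr (- \<gamma>)) \<partial>lborel)
    \<le> ennreal (convolution_const (real DIM('a)) \<beta> \<gamma> * norm u powr (real DIM('a) - \<beta> - \<gamma>))"
proof -
  define n where "n = real DIM('a)"
  have n: "\<beta> < n" "\<gamma> < n" "n < \<beta> + \<gamma>" using \<beta> \<gamma> s by (simp_all add: n_def)
  define R where "R = norm u / 2"
  have R: "R > 0" using u by (simp add: R_def)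
  define \<Phi> where "\<Phi> p q k = ennreal (norm k powr (- p) * max R (norm k) powr (- q))" for p q and k :: 'a
  have [measurable]: "\<Phi> p q \<in> borel_measurable borel" for p q
    unfolding \<Phi>_def[abs_def] by measurable
  have tri: "R \<le> max (norm k) (norm (u + k))" for k
    using norm_triangle_ineq4[of "u + k" k] by (simp add: R_def)
  have pointwise: "ennreal (norm k powr (- \<beta>) * norm (u + k) powr (- \<gamma>)) \<le> \<Phi> \<beta> \<gamma> k + \<Phi> \<gamma> \<beta> (u + k)" for k
  proof (cases "norm k \<le> norm (u + k)")
    case True
    then have "norm (u + k) powr (- \<gamma>) \<le> max R (norm k) powr (- \<gamma>)"
      using tri[of k] R \<gamma> by (intro powr_mono2') (auto simp: max_def split: if_splits)
    then have "ennreal (norm k powr (- \<beta>) * norm (u + k) powr (- \<gamma>)) \<le> \<Phi> \<beta> \<gamma> k"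
      unfolding \<Phi>_def by (intro ennreal_leI mult_left_mono) auto
    then show ?thesis by (rule order_trans) simp
  next
    case False
    then have "norm k powr (- \<beta>) \<le> max R (norm (u + k)) powr (- \<beta>)"
      using tri[of k] R \<beta> by (intro powr_mono2') (auto simp: max_def split: if_splits)
    then have "norm (u + k) powr (- \<gamma>) * norm k powr (- \<beta>) \<le> norm (u + k) powr (- \<gamma>) * max R (norm (u + k)) powr (- \<beta>)"
      by (intro mult_left_mono) auto
    then have "ennreal (norm k powr (- \<beta>) * norm (u + k) powr (- \<gamma>)) \<le> \<Phi> \<gamma> \<beta> (u + k)"
      unfolding \<Phi>_def by (intro ennreal_leI) (simp add: mult.commute)
    then show ?thesis by (rule order_trans) simp
  qed
  have "(\<integral>\<^sup>+k. ennreal (norm k powr (- \<beta>) * norm (u + k) powr (- \<gamma>)) \<partial>lborel)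
      \<le> (\<integral>\<^sup>+k. \<Phi> \<beta> \<gamma> k + \<Phi> \<gamma> \<beta> (u + k) \<partial>lborel)"
    by (intro nn_integral_mono pointwise)
  also have "\<dots> = (\<integral>\<^sup>+k. \<Phi> \<beta> \<gamma> k \<partial>lborel) + (\<integral>\<^sup>+k. \<Phi> \<gamma> \<beta> k \<partial>lborel)"
    by (subst nn_integral_add) (auto simp: nn_integral_lborel_translate)
  also have "\<dots> \<le> ennreal (unit_ball_vol n * R powr (n - \<beta> - \<gamma>) * (\<beta> / (n - \<beta>) + (\<beta> + \<gamma>) / (\<beta> + \<gamma> - n)))
      + ennreal (unit_ball_vol n * R powr (n - \<gamma> - \<beta>) * (\<gamma> / (n - \<gamma>) + (\<gamma> + \<beta>) / (\<gamma> + \<beta> - n)))"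
    unfolding \<Phi>_def n_def using assms R by (intro add_mono nn_integral_two_power_radial) auto
  also have "\<dots> = ennreal (unit_ball_vol n * R powr (n - \<beta> - \<gamma>)
      * (\<beta> / (n - \<beta>) + \<gamma> / (n - \<gamma>) + 2 * (\<beta> + \<gamma>) / (\<beta> + \<gamma> - n)))"
  proof -
    define P where "P = unit_ball_vol n * R powr (n - \<beta> - \<gamma>)"
    define T where "T = (\<beta> + \<gamma>) / (\<beta> + \<gamma> - n)"
    have nonneg: "0 \<le> P" "0 \<le> \<beta> / (n - \<beta>)" "0 \<le> \<gamma> / (n - \<gamma>)" "0 \<le> T"
      using n \<beta> \<gamma> by (simp_all add: P_def T_def n_def)
    have "ennreal (P * (\<beta> / (n - \<beta>) + T)) + ennreal (P * (\<gamma> / (n - \<gamma>) + T))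
        = ennreal (P * (\<beta> / (n - \<beta>) + T) + P * (\<gamma> / (n - \<gamma>) + T))"
      using nonneg by (intro ennreal_plus[symmetric] mult_nonneg_nonneg add_nonneg_nonneg)
    also have "P * (\<beta> / (n - \<beta>) + T) + P * (\<gamma> / (n - \<gamma>) + T) = P * (\<beta> / (n - \<beta>) + \<gamma> / (n - \<gamma>) + 2 * T)"
      by (simp add: distrib_left)
    finally show ?thesis
      by (simp only: P_def T_def add.commute[of \<gamma> \<beta>] cancel_ab_semigroup_add_class.diff_right_commute[of n \<gamma> \<beta>] times_divide_eq_right)
  qed
  also have "R powr (n - \<beta> - \<gamma>) = norm u powr (n - \<beta> - \<gamma>) * 2 powr (\<beta> + \<gamma> - n)"
  proof -
    have "R powr (n - \<beta> - \<gamma>) = norm u powr (n - \<beta> - \<gamma>) * inverse (2 powr (n - \<beta> - \<gamma>))"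
      unfolding R_def by (subst powr_divide) (simp_all add: divide_inverse)
    also have "inverse (2 powr (n - \<beta> - \<gamma>)) = 2 powr - (n - \<beta> - \<gamma>)"
      by (rule powr_minus[symmetric])
    also have "- (n - \<beta> - \<gamma>) = \<beta> + \<gamma> - n" by simp
    finally show ?thesis .
  qed
  also have "unit_ball_vol n * (norm u powr (n - \<beta> - \<gamma>) * 2 powr (\<beta> + \<gamma> - n))
      * (\<beta> / (n - \<beta>) + \<gamma> / (n - \<gamma>) + 2 * (\<beta> + \<gamma>) / (\<beta> + \<gamma> - n))
      = convolution_const n \<beta> \<gamma> * norm u powr (n - \<beta> - \<gamma>)"
    unfolding convolution_const_def by (simp only: mult_ac)
  finally show ?thesis
    unfolding n_def .
qed

text \<open>
  Substituting \<open>k = t h\<close> extracts a power of \<open>t\<close> whose exponent exceeds \<open>-1\<close> as soon as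
  \<open>\<beta> > n - 1\<close>; this is what later makes the integral over \<open>0 < t < 1\<close> finite.
\<close>

lemma power_kernel_scaled_convolution_bound:
  fixes u :: "'a::euclidean_space" and \<beta> \<gamma> t :: real
  assumes "0 < \<beta>" "\<beta> < real DIM('a)" and "0 < \<gamma>" "\<gamma> < real DIM('a)"
    and "real DIM('a) < \<beta> + \<gamma>" and "u \<noteq> 0" and t: "t > 0"
  shows "(\<integral>\<^sup>+h. ennreal (norm h powr (- \<beta>) * norm (u + t *\<^sub>R h) powr (- \<gamma>)) \<partial>lborel)
    \<le> ennreal (t powr (\<beta> - real DIM('a)))
       * ennreal (convolution_const (real DIM('a)) \<beta> \<gamma> * norm u powr (real DIM('a) - \<beta> - \<gamma>))"
proof -
  let ?F = "\<lambda>k::'a. ennreal (norm k powr (- \<beta>) * norm (u + k) powr (- \<gamma>))"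
  have "ennreal (t powr (\<beta> - real DIM('a))) * (\<integral>\<^sup>+k. ?F k \<partial>lborel)
      = ennreal (t powr (\<beta> - real DIM('a)) * t ^ DIM('a)) * (\<integral>\<^sup>+h. ?F (t *\<^sub>R h) \<partial>lborel)"
    using t by (subst nn_integral_lborel_scale[of _ t]) (auto simp: ennreal_mult mult.assoc)
  also have "t powr (\<beta> - real DIM('a)) * t ^ DIM('a) = t powr \<beta>"
    using t by (simp add: powr_realpow[symmetric] powr_add[symmetric])
  also have "ennreal (t powr \<beta>) * (\<integral>\<^sup>+h. ?F (t *\<^sub>R h) \<partial>lborel)
      = (\<integral>\<^sup>+h. ennreal (t powr \<beta>) * ?F (t *\<^sub>R h) \<partial>lborel)"
    by (rule nn_integral_cmult[symmetric]) measurable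
  also have "\<dots> = (\<integral>\<^sup>+h. ennreal (norm h powr (- \<beta>) * norm (u + t *\<^sub>R h) powr (- \<gamma>)) \<partial>lborel)"
    using t by (intro nn_integral_cong)
      (simp add: ennreal_mult'[symmetric] powr_mult powr_minus field_simps)
  finally show ?thesis
    using mult_left_mono[OF power_kernel_convolution_bound[OF assms(1-6)], of "ennreal (t powr (\<beta> - real DIM('a)))"]
    by simp
qed

section \<open>Differences and gradients\<close>

lemma Cc_infinity_differentiable:
  "f \<in> Cc_infinity \<Longrightarrow> f differentiable (at x)"
  unfolding Cc_infinity_def by (auto dest!: spec[where x = "Suc 0"])

lemma Cc_infinity_continuous_gradient:
  assumes "f \<in> Cc_infinity"
  shows "continuous_on UNIV (gradient f)"
proof -
  have "C_diff (Suc 0) f" using assms unfolding Cc_infinity_def by blast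
  then have "continuous_on UNIV (\<lambda>x. frechet_derivative f (at x) v)" for v
    by simp
  then show ?thesis
    unfolding gradient_def[abs_def] by (intro continuous_on_vec_lambda)
qed

lemma difference_le_integral_gradient:
  fixes f :: "real^'n \<Rightarrow> real"
  assumes d: "\<And>x. f differentiable (at x)" and c: "continuous_on UNIV (gradient f)"
  shows "ennreal \<bar>f y - f (y + h)\<bar>
    \<le> ennreal (norm h) * (\<integral>\<^sup>+t. ennreal (norm (gradient f (y + t *\<^sub>R h))) * indicator {0..1} t \<partial>lborel)"
proof -
  let ?D = "\<lambda>t. inner h (gradient f (y + t *\<^sub>R h))"
  let ?G = "\<lambda>t. norm (gradient f (y + t *\<^sub>R h))"
  have cg: "continuous_on {0..1} (\<lambda>t::real. gradient f (y + t *\<^sub>R h))"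
    by (intro continuous_on_compose2[OF c] continuous_intros) auto
  have "((\<lambda>t. f (y + t *\<^sub>R h)) has_vector_derivative ?D t) (at t within {0..1})" for t
  proof -
    have "(f has_derivative (\<lambda>k. inner k (gradient f (y + t *\<^sub>R h)))) (at (y + t *\<^sub>R h))"
      using GDERIV_gradient[OF d] by (simp add: gderiv_def)
    then show ?thesis
      unfolding has_vector_derivative_def
      by (intro has_derivative_eq_rhs[OF has_derivative_compose[where g = f and f = "\<lambda>t. y + t *\<^sub>R h"]])
         (auto intro!: derivative_eq_intros)
  qed
  then have "(?D has_integral (f (y + 1 *\<^sub>R h) - f (y + 0 *\<^sub>R h))) {0..1}"
    by (intro fundamental_theorem_of_calculus) auto
  then have I: "(?D has_integral (f (y + h) - f y)) {0..1}" by simp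
  have G: "?G integrable_on {0..1}"
    by (intro integrable_continuous_real continuous_intros cg)
  have "\<bar>f y - f (y + h)\<bar> = norm (integral {0..1} ?D)"
    using integral_unique[OF I] by simp
  also have "\<dots> \<le> integral {0..1} (\<lambda>t. norm h * ?G t)"
  proof (rule integral_norm_bound_integral)
    show "?D integrable_on {0..1}" using I by blast
    show "(\<lambda>t. norm h * ?G t) integrable_on {0..1}" using G by (rule integrable_on_mult_right)
  qed (simp add: Cauchy_Schwarz_ineq2)
  also have "\<dots> = norm h * integral {0..1} ?G" by simp
  finally have "ennreal \<bar>f y - f (y + h)\<bar> \<le> ennreal (norm h) * ennreal (integral {0..1} ?G)"
    by (simp add: ennreal_mult'[symmetric] ennreal_leI)
  also have "ennreal (integral {0..1} ?G) = (\<integral>\<^sup>+t. ennreal (?G t) * indicator {0..1} t \<partial>lborel)"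
    by (intro nn_integral_indicator_has_integral[symmetric] integrable_integral G) simp
  finally show ?thesis .
qed

text \<open>
  One factor \<open>\<bar>h\<bar>\<close> from the mean value inequality lowers the order of the singularity from
  \<open>n + \<alpha>\<close> to \<open>n + \<alpha> - 1\<close>, which is below \<open>n\<close> when \<open>\<alpha> < 1\<close>.
\<close>

lemma nonlinear_frac_diff_le_gradient:
  fixes f :: "real^'n \<Rightarrow> real"
  assumes d: "\<And>x. f differentiable (at x)" and c: "continuous_on UNIV (gradient f)"
  shows "nonlinear_frac_diff \<alpha> f y
    \<le> (\<integral>\<^sup>+h. (\<integral>\<^sup>+t. ennreal (norm (gradient f (y + t *\<^sub>R h))) * indicator {0..1} t \<partial>lborel)
           * ennreal (norm h powr (- (real CARD('n) + \<alpha> - 1))) \<partial>lborel)"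
proof -
  have [measurable]: "f \<in> borel_measurable borel"
    using d by (intro borel_measurable_continuous_onI)
       (auto intro!: differentiable_imp_continuous_within simp: continuous_on_eq_continuous_within)
  let ?p = "real CARD('n) + \<alpha>"
  have "nonlinear_frac_diff \<alpha> f y
      = (\<integral>\<^sup>+h. ennreal (\<bar>f y - f (y + h)\<bar> / norm (y - (y + h)) powr ?p) \<partial>lborel)"
    unfolding nonlinear_frac_diff_def
    by (rule nn_integral_lborel_translate[symmetric]) measurable
  also have "\<dots> \<le> (\<integral>\<^sup>+h. (\<integral>\<^sup>+t. ennreal (norm (gradient f (y + t *\<^sub>R h))) * indicator {0..1} t \<partial>lborel)
           * ennreal (norm h powr (- (?p - 1))) \<partial>lborel)"
  proof (rule nn_integral_mono)
    fix h :: "real^'n"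
    let ?I = "\<integral>\<^sup>+t. ennreal (norm (gradient f (y + t *\<^sub>R h))) * indicator {0..1} t \<partial>lborel"
    have "ennreal (\<bar>f y - f (y + h)\<bar> / norm (y - (y + h)) powr ?p)
        = ennreal \<bar>f y - f (y + h)\<bar> * ennreal (norm h powr (- ?p))"
      by (simp add: ennreal_mult'[symmetric] powr_minus[symmetric] divide_inverse)
    also have "\<dots> \<le> (ennreal (norm h) * ?I) * ennreal (norm h powr (- ?p))"
      by (intro mult_right_mono difference_le_integral_gradient d c) simp
    also have "\<dots> = ?I * ennreal (norm h * norm h powr (- ?p))"
      by (simp add: ennreal_mult' mult_ac)
    also have "norm h * norm h powr (- ?p) = norm h powr (- (?p - 1))"
      by (cases "h = 0") (simp_all add: powr_mult_base algebra_simps)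
    finally show "ennreal (\<bar>f y - f (y + h)\<bar> / norm (y - (y + h)) powr ?p)
        \<le> ?I * ennreal (norm h powr (- (?p - 1)))" .
  qed
  finally show ?thesis .
qed

section \<open>The estimate\<close>

text \<open>
  With negative powers in place of division, the kernel is an ordinary finite function and products
  can be rearranged freely; the two integrands may differ at \<open>y = x\<close>, where the quotient is
  infinite for \<open>p < n\<close> unless \<open>g y = 0\<close>.
\<close>

lemma riesz_potential_eq:
  fixes x :: "real^'n"
  shows "riesz_potential p g x = (\<integral>\<^sup>+y. g y * ennreal (norm (x - y) powr (- (real CARD('n) - p))) \<partial>lborel)"
  unfolding riesz_potential_def
proof (rule nn_integral_cong_AE, use AE_lborel_singleton[of x] in eventually_elim)
  case (elim y)
  then have "norm (x - y) powr (real CARD('n) - p) > 0" by simp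
  then show ?case
    by (simp add: divide_ennreal_def inverse_ennreal powr_minus[symmetric])
qed

text \<open>
  The exponents \<open>\<beta> = n + \<alpha> - 1\<close> and \<open>\<gamma> = n - \<alpha>\<close> add up to \<open>2 n - 1\<close>, so the convolution of the
  two kernels is of order \<open>n - (2 n - 1) = 1 - n\<close>, independently of \<open>\<alpha>\<close>; the condition
  \<open>\<beta> + \<gamma> > n\<close> is where \<open>n \<ge> 2\<close> enters.
\<close>

lemma riesz_nonlinear_frac_diff_le_riesz_gradient:
  fixes f :: "real^'n \<Rightarrow> real" and x :: "real^'n"
  assumes n: "CARD('n) \<ge> 2" and \<alpha>: "0 < \<alpha>" "\<alpha> < 1"
    and d: "\<And>x. f differentiable (at x)" and c: "continuous_on UNIV (gradient f)"
  shows "riesz_potential \<alpha> (nonlinear_frac_diff \<alpha> f) x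
    \<le> ennreal (convolution_const (real CARD('n)) (real CARD('n) + \<alpha> - 1) (real CARD('n) - \<alpha>) / \<alpha>)
       * riesz_potential 1 (\<lambda>y. ennreal (norm (gradient f y))) x"
proof -
  define N where "N = real CARD('n)"
  have N: "N \<ge> 2" using n by (simp add: N_def)
  let ?K = "convolution_const N (N + \<alpha> - 1) (N - \<alpha>)"
  have K: "?K \<ge> 0"
    using \<alpha> N unfolding convolution_const_def by (intro mult_nonneg_nonneg add_nonneg_nonneg divide_nonneg_nonneg) auto
  define g where "g w = ennreal (norm (gradient f w))" for w
  define b where "b h = ennreal (norm h powr (- (N + \<alpha> - 1)))" for h :: "real^'n"
  define a where "a u = ennreal (norm u powr (- (N - \<alpha>)))" for u :: "real^'n"
  define I where "I t = (indicator {0..1} t :: ennreal)" for t :: real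
  have [measurable]: "gradient f \<in> borel_measurable borel"
    by (intro borel_measurable_continuous_onI c)
  have [measurable]: "g \<in> borel_measurable borel" "b \<in> borel_measurable borel"
      "a \<in> borel_measurable borel" "I \<in> borel_measurable borel"
    unfolding g_def[abs_def] a_def[abs_def] b_def[abs_def] I_def[abs_def] by measurable
  \<comment> \<open>Integrate first in \<open>y\<close>, to substitute \<open>w = y + t h\<close>; then move the \<open>w\<close>-integral outermost.\<close>
  have "riesz_potential \<alpha> (nonlinear_frac_diff \<alpha> f) x
      \<le> (\<integral>\<^sup>+y. (\<integral>\<^sup>+h. (\<integral>\<^sup>+t. g (y + t *\<^sub>R h) * I t \<partial>lborel) * b h \<partial>lborel) * a (x - y) \<partial>lborel)"
    unfolding riesz_potential_eq N_def a_def b_def g_def I_def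
    by (intro nn_integral_mono mult_right_mono nonlinear_frac_diff_le_gradient d c) simp
  also have "\<dots> = (\<integral>\<^sup>+y. \<integral>\<^sup>+h. \<integral>\<^sup>+t. g (y + t *\<^sub>R h) * I t * b h * a (x - y) \<partial>lborel \<partial>lborel \<partial>lborel)"
    by (simp add: nn_integral_multc)
  also have "\<dots> = (\<integral>\<^sup>+h. \<integral>\<^sup>+y. \<integral>\<^sup>+t. g (y + t *\<^sub>R h) * I t * b h * a (x - y) \<partial>lborel \<partial>lborel \<partial>lborel)"
    by (rule lborel_pair.Fubini') measurable
  also have "\<dots> = (\<integral>\<^sup>+h. \<integral>\<^sup>+t. \<integral>\<^sup>+y. g (y + t *\<^sub>R h) * I t * b h * a (x - y) \<partial>lborel \<partial>lborel \<partial>lborel)"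
    by (rule nn_integral_cong, rule lborel_pair.Fubini') measurable
  also have "\<dots> = (\<integral>\<^sup>+h. \<integral>\<^sup>+t. \<integral>\<^sup>+w. g w * I t * b h * a (x - w + t *\<^sub>R h) \<partial>lborel \<partial>lborel \<partial>lborel)"
  proof (rule nn_integral_cong, rule nn_integral_cong)
    fix h :: "real^'n" and t :: real
    show "(\<integral>\<^sup>+y. g (y + t *\<^sub>R h) * I t * b h * a (x - y) \<partial>lborel)
        = (\<integral>\<^sup>+w. g w * I t * b h * a (x - w + t *\<^sub>R h) \<partial>lborel)"
      by (subst nn_integral_lborel_translate[of "\<lambda>w. g w * I t * b h * a (x - w + t *\<^sub>R h)" "t *\<^sub>R h", symmetric])
         (simp_all add: algebra_simps)
  qed
  also have "\<dots> = (\<integral>\<^sup>+h. \<integral>\<^sup>+w. \<integral>\<^sup>+t. g w * I t * b h * a (x - w + t *\<^sub>R h) \<partial>lborel \<partial>lborel \<partial>lborel)"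
    by (rule nn_integral_cong, rule lborel_pair.Fubini') measurable
  also have "\<dots> = (\<integral>\<^sup>+w. \<integral>\<^sup>+h. \<integral>\<^sup>+t. g w * I t * b h * a (x - w + t *\<^sub>R h) \<partial>lborel \<partial>lborel \<partial>lborel)"
    by (rule lborel_pair.Fubini') measurable
  also have "\<dots> = (\<integral>\<^sup>+w. \<integral>\<^sup>+t. \<integral>\<^sup>+h. g w * I t * b h * a (x - w + t *\<^sub>R h) \<partial>lborel \<partial>lborel \<partial>lborel)"
    by (rule nn_integral_cong, rule lborel_pair.Fubini') measurable
  also have "\<dots> = (\<integral>\<^sup>+w. g w * (\<integral>\<^sup>+t. I t * (\<integral>\<^sup>+h. b h * a (x - w + t *\<^sub>R h) \<partial>lborel) \<partial>lborel) \<partial>lborel)"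
    by (simp add: nn_integral_cmult mult.assoc)
  also have "\<dots> \<le> (\<integral>\<^sup>+w. g w * (ennreal (?K / \<alpha>) * ennreal (norm (x - w) powr (- (N - 1)))) \<partial>lborel)"
  proof (rule nn_integral_mono_AE, use AE_lborel_singleton[of x] in eventually_elim)
    case (elim w)
    let ?C = "ennreal (?K * norm (x - w) powr (- (N - 1)))"
    have "(\<integral>\<^sup>+t. I t * (\<integral>\<^sup>+h. b h * a (x - w + t *\<^sub>R h) \<partial>lborel) \<partial>lborel)
        \<le> (\<integral>\<^sup>+t. (ennreal (t powr (\<alpha> - 1)) * indicator {0..1} t) * ?C \<partial>lborel)"
    proof (rule nn_integral_mono_AE, use AE_lborel_singleton[of "0::real"] in eventually_elim)
      case (elim t)
      have "(\<integral>\<^sup>+h. b h * a (x - w + t *\<^sub>R h) \<partial>lborel) \<le> ennreal (t powr (\<alpha> - 1)) * ?C" if t: "t > 0"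
      proof -
        have "(\<integral>\<^sup>+h. b h * a (x - w + t *\<^sub>R h) \<partial>lborel)
            = (\<integral>\<^sup>+h. ennreal (norm h powr (- (N + \<alpha> - 1)) * norm (x - w + t *\<^sub>R h) powr (- (N - \<alpha>))) \<partial>lborel)"
          by (simp add: a_def b_def ennreal_mult')
        also have "\<dots> \<le> ennreal (t powr (N + \<alpha> - 1 - real DIM(real^'n)))
           * ennreal (convolution_const (real DIM(real^'n)) (N + \<alpha> - 1) (N - \<alpha>)
              * norm (x - w) powr (real DIM(real^'n) - (N + \<alpha> - 1) - (N - \<alpha>)))"
          using \<alpha> N t \<open>w \<noteq> x\<close> by (intro power_kernel_scaled_convolution_bound) (auto simp: N_def)
        also have "\<dots> = ennreal (t powr (\<alpha> - 1)) * ?C"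
          by (simp add: N_def[symmetric] algebra_simps)
        finally show ?thesis .
      qed
      then show ?case
        using elim by (auto simp: I_def split: split_indicator)
    qed
    also have "\<dots> = ennreal (1 / \<alpha>) * ?C"
      using \<alpha> by (subst nn_integral_multc) (auto simp: nn_integral_powr_from_0)
    also have "\<dots> = ennreal (?K / \<alpha>) * ennreal (norm (x - w) powr (- (N - 1)))"
      using \<alpha> K by (simp add: ennreal_mult'[symmetric])
    finally show ?case by (rule mult_left_mono) simp
  qed
  also have "\<dots> = ennreal (?K / \<alpha>) * (\<integral>\<^sup>+w. g w * ennreal (norm (x - w) powr (- (N - 1))) \<partial>lborel)"
    by (subst nn_integral_cmult[symmetric]) (auto simp: mult_ac)
  also have "(\<integral>\<^sup>+w. g w * ennreal (norm (x - w) powr (- (N - 1))) \<partial>lborel)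
      = riesz_potential 1 (\<lambda>y. ennreal (norm (gradient f y))) x"
    by (simp add: riesz_potential_eq g_def N_def)
  finally show ?thesis by (simp add: N_def)
qed

theorem lemma2p6:
  assumes "CARD('n::finite) \<ge> 2"
  shows "\<exists>c :: real \<Rightarrow> real.
    (\<forall>\<alpha>. 0 < \<alpha> \<and> \<alpha> < 1 \<longrightarrow> 0 \<le> c \<alpha> \<and>
      (\<forall>f \<in> (Cc_infinity :: (real^'n \<Rightarrow> real) set). \<forall>x.
        ennreal (1 - \<alpha>) * riesz_potential \<alpha> (nonlinear_frac_diff \<alpha> f) x
          \<le> ennreal (c \<alpha>) * riesz_potential 1 (\<lambda>y. ennreal (norm (gradient f y))) x)) \<and>
    (\<exists>C. \<forall>\<^sub>F \<alpha> in at_left 1. c \<alpha> \<le> C)"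
proof -
  define N where "N = real CARD('n)"
  have N: "N \<ge> 2" using assms by (simp add: N_def)
  define K where "K \<alpha> = convolution_const N (N + \<alpha> - 1) (N - \<alpha>)" for \<alpha>
  define c where "c \<alpha> = (1 - \<alpha>) * (K \<alpha> / \<alpha>)" for \<alpha>
  \<comment> \<open>\<open>B\<close> is \<open>c\<close> with the factor \<open>1 - \<alpha>\<close> multiplied out; unlike \<open>c\<close>, it is continuous at \<open>1\<close>.\<close>
  define B where "B \<alpha> = unit_ball_vol N * 2 powr (N - 1) *
      (N + \<alpha> - 1 + (1 - \<alpha>) * ((N - \<alpha>) / \<alpha> + 2 * (2 * N - 1) / (N - 1))) / \<alpha>" for \<alpha>
  have K: "K \<alpha> \<ge> 0" if "0 < \<alpha>" "\<alpha> < 1" for \<alpha>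
    using that N unfolding K_def convolution_const_def
    by (intro mult_nonneg_nonneg add_nonneg_nonneg divide_nonneg_nonneg) auto
  have main: "0 \<le> c \<alpha> \<and>
      (\<forall>f \<in> (Cc_infinity :: (real^'n \<Rightarrow> real) set). \<forall>x.
        ennreal (1 - \<alpha>) * riesz_potential \<alpha> (nonlinear_frac_diff \<alpha> f) x
          \<le> ennreal (c \<alpha>) * riesz_potential 1 (\<lambda>y. ennreal (norm (gradient f y))) x)"
    if \<alpha>: "0 < \<alpha>" "\<alpha> < 1" for \<alpha>
  proof (intro conjI ballI allI)
    show "0 \<le> c \<alpha>" using \<alpha> K[OF \<alpha>] by (simp add: c_def)
    fix f :: "real^'n \<Rightarrow> real" and x assume f: "f \<in> Cc_infinity"
    show "ennreal (1 - \<alpha>) * riesz_potential \<alpha> (nonlinear_frac_diff \<alpha> f) x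
          \<le> ennreal (c \<alpha>) * riesz_potential 1 (\<lambda>y. ennreal (norm (gradient f y))) x"
    proof -
      have "ennreal (c \<alpha>) = ennreal (1 - \<alpha>) * ennreal (K \<alpha> / \<alpha>)"
        unfolding c_def using \<alpha> by (intro ennreal_mult') simp
      then show ?thesis
        using mult_left_mono[OF riesz_nonlinear_frac_diff_le_riesz_gradient[OF assms \<alpha>
            Cc_infinity_differentiable[OF f] Cc_infinity_continuous_gradient[OF f], of x], of "ennreal (1 - \<alpha>)"]
        by (simp add: K_def N_def mult.assoc)
    qed
  qed
  have "\<forall>\<^sub>F \<alpha> in at_left 1. c \<alpha> \<le> B 1 + 1"
  proof -
    have "(B \<longlongrightarrow> B 1) (at_left 1)"
      unfolding B_def[abs_def] using N by (intro tendsto_intros) auto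
    then have "\<forall>\<^sub>F \<alpha> in at_left 1. B \<alpha> < B 1 + 1"
      by (rule order_tendstoD) simp
    moreover have "\<forall>\<^sub>F \<alpha> in at_left 1. \<alpha> \<in> {0<..<1::real}"
      by (rule eventually_at_leftI[of 0]) auto
    ultimately show ?thesis
    proof eventually_elim
      case (elim \<alpha>)
      then have "c \<alpha> = B \<alpha>"
        by (simp add: c_def K_def B_def convolution_const_def field_simps)
      then show ?case using elim by simp
    qed
  qed
  then show ?thesis using main by blast
qed

end
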